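(* Let $z>-1$ be real and $\lambda,t\in\mathbb{C}$. Suppose that $|t|<z^{-2}-1$ in the case $-1<z<-2^{-1/2}$ and $-\lambda\notin\mathbb{N}$, and that $|t|<1$ in the case $z\ge-2^{-1/2}$ or $-\lambda\in\mathbb{N}$. Then $$f_\lambda(t,z)=\left(1+z\sqrt{1-t}\right)^{-\lambda}=\sum_{n=0}^{\infty}\frac{\mathfrak{A}_n^{(\lambda)}(z)}{2^n n!}\,t^n,$$ where $$\mathfrak{A}_n^{(\lambda)}(z)=\frac{(\lambda)_n z^n}{(z+1)^{\lambda+n}}\,F\left(1-n,n;1-n-\lambda;\frac{1+z}{2z}\right),$$ and also, if $-\lambda\in\mathbb{N}_0$ or $|z|<1$, $$\mathfrak{A}_n^{(\lambda)}(z)=2^n\sum_{j=0}^{\infty}\frac{(-1)^{j+n}(\lambda)_j\,\Gamma\left(\frac j2+1\right)}{\Gamma\left(\frac j2-n+1\right)}\,\frac{z^j}{j!}.$$ The functions $\mathfrak{A}_n^{(\lambda)}(z)$ are analytic functions of the parameter $\lambda$ obeying, for $n\in\mathbb{N}_0$, the recurrence relations $$\mathfrak{A}_{n+1}^{(\lambda)}(z)=2n\,\mathfrak{A}_n^{(\lambda)}(z)-z\frac{d\mathfrak{A}_n^{(\lambda)}(z)}{dz},\qquad \mathfrak{A}_0^{(\lambda)}(z)=\frac{1}{(1+z)^{\lambda}},\quad \mathfrak{A}_1^{(\lambda)}(z)=\frac{\lambda z}{(1+z)^{\lambda+1}},$$ and $$(z^2-1)\,\mathfrak{A}_{n+2}^{(\lambda)}(z)+\alpha(z,\lambda,n)\,\mathfrak{A}_{n+1}^{(\lambda)}(z)+\beta(\lambda,n)\,z^2\,\mathfrak{A}_n^{(\lambda)}(z)=0,$$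 where $\alpha(z,\lambda,n)=2n+1-(4n+2\lambda+3)z^2$ and $\beta(\lambda,n)=4n^2+2n(2\lambda+1)+\lambda(\lambda+1)$.
   Context: $F$ is the Gauss hypergeometric function (a terminating sum in the formula for $\mathfrak{A}_n^{(\lambda)}$), $(a)_n=\Gamma(a+n)/\Gamma(a)$, $\mathbb{N}=\{1,2,\dots\}$, $\mathbb{N}_0=\{0,1,2,\dots\}$, and $1/\Gamma$ is the entire reciprocal gamma function. The square root is principal ($\sqrt{1-t}=1$ at $t=0$) and $(1+z\sqrt{1-t})^{-\lambda}$ is the analytic branch in $t$ equal to $(1+z)^{-\lambda}>0$-based principal power at $t=0$. The product $(\lambda)_n z^n F(1-n,n;1-n-\lambda;\frac{1+z}{2z})$ is, for each $n$, a polynomial in $\lambda$ and $z$, and is read as its limiting value at those $\lambda$ and $z$ (e.g. $z=0$, or $-\lambda\in\{0,\dots,n-1\}$) where an individual factor is undefined. *)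

theory Defs
  imports "HOL-Analysis.Analysis"
begin

(* With x / 0 = 0, coefficients whose denominator pochhammer symbol vanishes count as 0. *)
definition gauss_F :: "complex \<Rightarrow> complex \<Rightarrow> complex \<Rightarrow> complex \<Rightarrow> complex" where
  "gauss_F a b c x = eval_fps (fps_hypergeo [a, b] [c] 1) x"

lemma gauss_F_series:
  "gauss_F a b c x =
     (\<Sum>k. pochhammer a k * pochhammer b k / (pochhammer c k * fact k) * x ^ k)"
  by (simp add: gauss_F_def eval_fps_def)

(* csqrt and powr are principal; lemma gen_f_holomorphic below shows that on the relevant disc
   this is the analytic branch in t starting from the principal power of 1 + z at t = 0. *)
definition gen_f :: "complex \<Rightarrow> complex \<Rightarrow> real \<Rightarrow> complex" where
  "gen_f l t z = (1 + of_real z * csqrt (1 - t)) powr (- l)"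

definition raw_P :: "nat \<Rightarrow> complex \<Rightarrow> real \<Rightarrow> complex" where
  "raw_P n l z = pochhammer l n * of_real z ^ n *
     gauss_F (1 - of_nat n) (of_nat n) (1 - of_nat n - l) (of_real ((1 + z) / (2 * z)))"

definition regular_pts :: "nat \<Rightarrow> (complex \<times> real) set" where
  "regular_pts n = {(l, z). z \<noteq> 0 \<and> - l \<notin> of_nat ` {..<n}}"

(* The limit is the joint one in (l, z); lemma frak_P_polynomial below shows that it exists. *)
definition frak_P :: "nat \<Rightarrow> complex \<Rightarrow> real \<Rightarrow> complex" where
  "frak_P n l z =
     (if (l, z) \<in> regular_pts n then raw_P n l z
      else Lim (at (l, z) within regular_pts n) (\<lambda>(l', z'). raw_P n l' z'))"

definition frak_A :: "nat \<Rightarrow> complex \<Rightarrow> real \<Rightarrow> complex" where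
  "frak_A n l z = frak_P n l z / of_real (z + 1) powr (l + of_nat n)"

definition rec_alpha :: "real \<Rightarrow> complex \<Rightarrow> nat \<Rightarrow> complex" where
  "rec_alpha z l n = 2 * of_nat n + 1 - (4 * of_nat n + 2 * l + 3) * of_real z ^ 2"

definition rec_beta :: "complex \<Rightarrow> nat \<Rightarrow> complex" where
  "rec_beta l n = 4 * of_nat n ^ 2 + 2 * of_nat n * (2 * l + 1) + l * (l + 1)"


lemma pochhammer_shift:
  fixes l :: complex
  assumes "k \<le> n"
  shows "pochhammer l n = pochhammer l (n - k) * ((- 1) ^ k * pochhammer (1 - of_nat n - l) k)"
proof -
  have "pochhammer l n = pochhammer l (n - k) * pochhammer (l + of_nat (n - k)) k"
    using pochhammer_product[of "n - k" n l] assms by simp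
  moreover have "pochhammer (1 - of_nat n - l) k = (- 1) ^ k * pochhammer (l + of_nat (n - k)) k"
    using pochhammer_minus[of "l + of_nat n - 1" k] assms
    by (simp add: of_nat_diff algebra_simps)
  ultimately show ?thesis
    by (simp flip: power_add mult.assoc)
qed

lemma raw_P_polynomial:
  assumes "(l, z) \<in> regular_pts n"
  shows "raw_P n l z =
    (\<Sum>k\<le>n. (- 1) ^ k * pochhammer (1 - of_nat n) k * pochhammer (of_nat n) k / fact k *
       pochhammer l (n - k) * of_real z ^ (n - k) * of_real ((1 + z) / 2) ^ k)"
proof -
  have z: "z \<noteq> 0" and l: "- l \<notin> of_nat ` {..<n}"
    using assms by (auto simp: regular_pts_def)
  have pn: "pochhammer l n \<noteq> 0"
    using l by (auto simp: pochhammer_eq_0_iff image_iff)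
  let ?x = "of_real ((1 + z) / (2 * z)) :: complex"
  let ?g = "\<lambda>k. pochhammer (1 - of_nat n) k * pochhammer (of_nat n) k /
              (pochhammer (1 - of_nat n - l) k * fact k) * ?x ^ k"
  have zero: "?g k = 0" if "k \<notin> {..n}" for k
  proof (cases "n = 0")
    case True
    then show ?thesis using that by (simp add: pochhammer_0_left)
  next
    case False
    then have "pochhammer (1 - of_nat n :: complex) k = 0"
      using that
      by (auto simp: pochhammer_eq_0_iff intro!: exI[of _ "n - 1"])
    then show ?thesis by simp
  qed
  have "raw_P n l z = pochhammer l n * of_real z ^ n * (\<Sum>k\<le>n. ?g k)"
    unfolding raw_P_def gauss_F_series by (subst suminf_finite[OF finite_atMost zero]) auto
  also have "\<dots> = (\<Sum>k\<le>n. pochhammer l n * of_real z ^ n * ?g k)"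
    by (rule sum_distrib_left)
  also have "\<dots> = (\<Sum>k\<le>n. (- 1) ^ k * pochhammer (1 - of_nat n) k * pochhammer (of_nat n) k / fact k *
       pochhammer l (n - k) * of_real z ^ (n - k) * of_real ((1 + z) / 2) ^ k)"
  proof (rule sum.cong[OF refl])
    fix k assume "k \<in> {..n}"
    then have k: "k \<le> n" by simp
    let ?c = "pochhammer (1 - of_nat n - l) k"
    have c: "?c \<noteq> 0" and ln: "pochhammer l n / ?c = pochhammer l (n - k) * (- 1) ^ k"
      using pn pochhammer_shift[OF k, of l] by auto
    have "?x = of_real ((1 + z) / 2) / of_real z"
      by simp
    then have xz: "of_real z ^ n * ?x ^ k = of_real z ^ (n - k) * of_real ((1 + z) / 2) ^ k"
      using z k by (simp only: power_divide) (simp add: power_diff)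
    have "pochhammer l n * of_real z ^ n * ?g k =
       (pochhammer l n / ?c) * (pochhammer (1 - of_nat n) k * pochhammer (of_nat n) k / fact k) *
       (of_real z ^ n * ?x ^ k)"
      by simp
    also have "\<dots> = (- 1) ^ k * pochhammer (1 - of_nat n) k * pochhammer (of_nat n) k / fact k *
       pochhammer l (n - k) * of_real z ^ (n - k) * of_real ((1 + z) / 2) ^ k"
      unfolding ln xz by simp
    finally show "pochhammer l n * of_real z ^ n * ?g k = \<dots>" .
  qed
  finally show ?thesis .
qed

lemma regular_pts_limit: "at (l, z) within regular_pts n \<noteq> bot"
proof
  assume bot: "at (l, z) within regular_pts n = bot"
  let ?B = "insert (- z) ((\<lambda>m. - Re l - real m) ` {..<n}) \<union> {0}"
  let ?h = "\<lambda>e::real. (l + of_real e, z + e)"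
  have "?h \<midarrow>0\<rightarrow> (l + of_real 0, z + 0)"
    by (intro tendsto_intros)
  then have lim: "?h \<midarrow>0\<rightarrow> (l, z)" by simp
  have "\<not> 0 islimpt ?B"
    by (rule islimpt_finite) auto
  then have "\<forall>\<^sub>F e in at 0. e \<notin> ?B"
    by (simp only: islimpt_iff_eventually not_not)
  then have ev: "\<forall>\<^sub>F e in at 0. ?h e \<in> regular_pts n \<and> ?h e \<noteq> (l, z)"
  proof eventually_elim
    case (elim e)
    have "- (l + of_real e) \<noteq> of_nat m" if "m < n" for m
    proof
      assume "- (l + of_real e) = of_nat m"
      then have "Re (- (l + of_real e)) = Re (of_nat m)" by (rule arg_cong)
      then have "e = - Re l - real m" by simp
      then show False using elim that by blast
    qed
    then show ?case using elim by (auto simp: regular_pts_def add_eq_0_iff2)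
  qed
  have "filterlim ?h (at (l, z) within regular_pts n) (at 0)"
    using lim ev by (simp add: filterlim_at)
  then have "filterlim ?h bot (at (0::real))" by (simp add: bot)
  then have "at (0::real) = bot" by (simp only: filterlim_def bot_unique filtermap_bot_iff)
  then show False by simp
qed

lemma frak_P_polynomial:
  "frak_P n l z =
    (\<Sum>k\<le>n. (- 1) ^ k * pochhammer (1 - of_nat n) k * pochhammer (of_nat n) k / fact k *
       pochhammer l (n - k) * of_real z ^ (n - k) * of_real ((1 + z) / 2) ^ k)"
  (is "_ = ?Q l z")
proof (cases "(l, z) \<in> regular_pts n")
  case True
  then show ?thesis by (simp add: frak_P_def raw_P_polynomial)
next
  case False
  let ?F = "at (l, z) within regular_pts n"
  have "((\<lambda>p. ?Q (fst p) (snd p)) \<longlongrightarrow> ?Q (fst (l, z)) (snd (l, z))) ?F"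
    unfolding pochhammer_prod by (intro tendsto_intros) auto
  moreover have "\<forall>\<^sub>F p in ?F. ?Q (fst p) (snd p) = (case p of (l', z') \<Rightarrow> raw_P n l' z')"
    unfolding eventually_at_filter
    by (intro always_eventually) (clarsimp simp only: fst_conv snd_conv raw_P_polynomial split: prod.splits)
  ultimately have "((\<lambda>(l', z'). raw_P n l' z') \<longlongrightarrow> ?Q l z) ?F"
    using tendsto_cong by fastforce
  then show ?thesis
    using False regular_pts_limit by (simp add: frak_P_def tendsto_Lim)
qed

lemma gen_f_holomorphic:
  assumes z: "z > - 1"
    and R: "R = (if z < - (2 powr (- 1 / 2)) \<and> - l \<notin> \<nat> - {0} then 1 / z ^ 2 - 1 else 1)"
  shows "(\<lambda>t. gen_f l t z) holomorphic_on ball 0 R" and "gen_f l 0 z = of_real (1 + z) powr (- l)"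
proof -
  have half: "(2 powr (- 1 / 2)) ^ 2 = (1 / 2 :: real)"
    by (simp add: powr_powr flip: powr_realpow)
  have R1: "R \<le> 1"
  proof (cases "z < - (2 powr (- 1 / 2))")
    case True
    then have "(2 powr (- 1 / 2)) ^ 2 \<le> (- z) ^ 2"
      by (intro power_mono) auto
    then have "1 / 2 \<le> z ^ 2" using half by simp
    then have "1 / z ^ 2 \<le> 2" by (simp add: divide_simps split: if_splits)
    then show ?thesis using R by simp
  qed (use R in simp)
  have pos: "1 - t \<notin> \<real>\<^sub>\<le>\<^sub>0" if "t \<in> ball 0 R" for t :: complex
  proof -
    have "Re t < 1" using that R1 complex_Re_le_cmod[of t] by simp
    then show ?thesis by (auto simp: complex_nonpos_Reals_iff)
  qed
  have sq: "(\<lambda>t. 1 + of_real z * csqrt (1 - t)) holomorphic_on ball 0 R"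
    using pos by (intro holomorphic_intros) auto
  show "(\<lambda>t. gen_f l t z) holomorphic_on ball 0 R"
  proof (cases "- l \<in> \<nat> - {0}")
    case True
    then obtain m where m: "- l = of_nat m" by (auto elim: Nats_cases)
    with True have m0: "m \<noteq> 0" by auto
    have "gen_f l t z = (1 + of_real z * csqrt (1 - t)) ^ m" for t
      unfolding gen_f_def m using m0 by (cases "1 + of_real z * csqrt (1 - t) = 0")
        (simp_all add: powr_nat')
    then show ?thesis using sq by (auto intro!: holomorphic_intros)
  next
    case False
    have "1 + of_real z * csqrt (1 - t) \<notin> \<real>\<^sub>\<le>\<^sub>0" if t: "t \<in> ball 0 R" for t :: complex
    proof
      assume "1 + of_real z * csqrt (1 - t) \<in> \<real>\<^sub>\<le>\<^sub>0"
      then obtain r where r: "r \<le> 0" "1 + of_real z * csqrt (1 - t) = of_real r"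
        by (auto elim!: nonpos_Reals_cases)
      then have zw: "of_real z * csqrt (1 - t) = of_real (r - 1)" by (simp add: algebra_simps)
      have "norm (of_real z * csqrt (1 - t)) \<ge> 1" unfolding zw using r(1)
        by (simp only: norm_of_real)
      then have "1 \<le> (norm (of_real z * csqrt (1 - t))) ^ 2" by simp
      also have "\<dots> = norm ((of_real z * csqrt (1 - t)) ^ 2)" by (simp only: norm_power)
      also have "\<dots> = z ^ 2 * norm (1 - t)"
        by (simp add: power_mult_distrib norm_mult norm_power)
      also have "\<dots> \<le> z ^ 2 * (1 + norm t)"
        by (intro mult_left_mono) (use norm_triangle_ineq4[of 1 t] in auto)
      finally have b: "1 \<le> z ^ 2 * (1 + norm t)" .
      have z0: "z \<noteq> 0" using b by auto
      have "Re (csqrt (1 - t)) \<ge> 0" using csqrt_principal[of "1 - t"] by auto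
      moreover have "z * Re (csqrt (1 - t)) = r - 1" using arg_cong[OF zw, of Re] by simp
      ultimately have neg: "z < 0" using r(1)
        by (smt (verit) mult_nonneg_nonneg)
      from b z0 have bt: "1 / z ^ 2 - 1 \<le> norm t" by (simp add: field_simps)
      show False
      proof (cases "z < - (2 powr (- 1 / 2))")
        case True
        then show False using bt t R False by simp
      next
        case F: False
        then have "(- z) ^ 2 \<le> (2 powr (- 1 / 2)) ^ 2"
          using neg by (intro power_mono) auto
        then have "z ^ 2 \<le> 1 / 2" using half by simp
        then have "2 \<le> 1 / z ^ 2" using z0 by (simp add: divide_simps)
        then show False using bt t R1 by simp
      qed
    qed
    then show ?thesis unfolding gen_f_def using sq pos by (intro holomorphic_intros) auto
  qed
  show "gen_f l 0 z = of_real (1 + z) powr (- l)"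
    by (simp add: gen_f_def)
qed

end

theory Submission
  imports Defs "HOL-Complex_Analysis.Cauchy_Integral_Formula"
begin

text \<open>
  With \<open>g\<^sub>m(w) = (\<lambda>)\<^sub>m w\<^sup>m (1 + w)\<^sup>-\<^sup>\<lambda>\<^sup>-\<^sup>m\<close> and the Euler operator \<open>\<theta> = w d/dw\<close> one has
  \<open>\<theta> g\<^sub>m = m g\<^sub>m - g\<^sub>m\<^sub>+\<^sub>1\<close>. The functions of the theorem are combinations of the \<open>g\<^sub>m\<close> whose
  coefficients obey exactly the recurrence that makes \<open>A\<^sub>n\<^sub>+\<^sub>1 = (2n - \<theta>) A\<^sub>n\<close>.
  Everything else follows from this raising relation by induction on \<open>n\<close>: the three-term recurrence, because
  \<open>2n + 2 - \<theta>\<close> maps the relation for \<open>n\<close> to the one for \<open>n + 1\<close>; the power series in \<open>z\<close>,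
  by termwise differentiation of the binomial series; and the Taylor coefficients in \<open>t\<close>, because
  with \<open>w = z \<surd>(1 - t)\<close> the operator \<open>d/dt\<close> is \<open>- \<theta> / (2 (1 - t))\<close>, so that the \<open>n\<close>-th
  \<open>t\<close>-derivative of \<open>(1 + w)\<^sup>-\<^sup>\<lambda>\<close> is \<open>A\<^sub>n(w) / (2 (1 - t))\<^sup>n\<close>.
\<close>

section \<open>The Euler operator on \<open>euler_g\<close>\<close>

text \<open>Complex arguments enter through \<open>z * csqrt (1 - t)\<close>; this cut makes all
  principal powers of \<open>1 + w\<close> holomorphic.\<close>

definition slit :: "complex set" where
  "slit = {w. 1 + w \<notin> \<real>\<^sub>\<le>\<^sub>0}"

lemma open_slit: "open slit"
proof -
  have "slit = (\<lambda>w. 1 + w) -` (- \<real>\<^sub>\<le>\<^sub>0)"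
    by (auto simp: slit_def)
  moreover have "open (- \<real>\<^sub>\<le>\<^sub>0 :: complex set)"
    by (simp add: open_Compl)
  moreover have "continuous_on UNIV (\<lambda>w :: complex. 1 + w)"
    by (intro continuous_intros)
  ultimately show ?thesis by (metis open_vimage)
qed

lemma slit_nonzero: "w \<in> slit \<Longrightarrow> 1 + w \<noteq> 0"
  by (auto simp: slit_def)

lemma of_real_in_slit: "x > - 1 \<Longrightarrow> of_real x \<in> slit"
  by (auto simp: slit_def complex_nonpos_Reals_iff)

definition euler_g :: "complex \<Rightarrow> nat \<Rightarrow> complex \<Rightarrow> complex" where
  "euler_g l m w = pochhammer l m * w ^ m * (1 + w) powr (- (l + of_nat m))"

text \<open>Differentiating the power of \<open>1 + w\<close> brings down \<open>- (l + m)\<close>,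
  which completes \<open>pochhammer l m\<close> to \<open>pochhammer l (Suc m)\<close>.\<close>

lemma euler_g_deriv:
  assumes w: "w \<in> slit"
  obtains d where "(euler_g l m has_field_derivative d) (at w)"
    and "w * d = of_nat m * euler_g l m w - euler_g l (Suc m) w"
proof
  define p q where "p = (1 + w) powr (- (l + of_nat m))" and "q = (1 + w) powr (- (l + of_nat m) - 1)"
  let ?d = "pochhammer l m * (of_nat m * w ^ (m - 1) * p - w ^ m * (l + of_nat m) * q)"
  show "(euler_g l m has_field_derivative ?d) (at w)"
    unfolding euler_g_def p_def q_def
    using w by (auto intro!: derivative_eq_intros simp: slit_def algebra_simps)
  have q: "(1 + w) powr (- (l + of_nat (Suc m))) = q"
    unfolding q_def by (rule arg_cong[where f = "\<lambda>a. (1 + w) powr a"]) simp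
  \<comment> \<open>For \<open>m = 0\<close> the truncated \<open>m - 1\<close> is \<open>0\<close>,
    but the factor \<open>of_nat m\<close> vanishes.\<close>
  have wm: "w * (of_nat m * w ^ (m - 1)) = of_nat m * w ^ m"
    by (cases m) auto
  have "w * ?d = pochhammer l m * ((w * (of_nat m * w ^ (m - 1))) * p - w ^ Suc m * (l + of_nat m) * q)"
    by (simp only: right_diff_distrib power_Suc mult_ac)
  also have "\<dots> = of_nat m * euler_g l m w - euler_g l (Suc m) w"
    unfolding wm by (simp only: euler_g_def pochhammer_Suc q p_def[symmetric] right_diff_distrib mult_ac)
  finally show "w * ?d = of_nat m * euler_g l m w - euler_g l (Suc m) w" .
qed

section \<open>Coefficients of the terminating hypergeometric sum\<close>

text \<open>What is left of the hypergeometric coefficient once its denominator symbol is cancelled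
  against \<open>pochhammer l n\<close>; \<open>2 ^ k\<close> comes from \<open>(1 + z) / 2\<close>.
  For \<open>n > 0\<close> these are the coefficients of the Bessel polynomial of degree
  \<open>n - 1\<close>.\<close>

definition hyp_coeff :: "nat \<Rightarrow> nat \<Rightarrow> complex" where
  "hyp_coeff n k =
     (- 1) ^ k * pochhammer (1 - of_nat n) k * pochhammer (of_nat n) k / (fact k * 2 ^ k)"

lemma hyp_coeff_0: "hyp_coeff n 0 = 1"
  by (simp add: hyp_coeff_def)

lemma hyp_coeff_eq_0: "hyp_coeff n (Suc n) = 0"
proof (cases n)
  case (Suc m)
  then have "pochhammer (1 - of_nat n :: complex) (Suc n) = 0"
    by (auto simp: pochhammer_eq_0_iff intro!: exI[of _ m])
  then show ?thesis by (simp add: hyp_coeff_def)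
qed (simp add: hyp_coeff_def)

text \<open>The raising relation in coefficients: \<open>2 n - \<theta>\<close> multiplies
  \<open>euler_g l (n - k)\<close> by \<open>2 n - (n - k) = n + k\<close> and adds a copy at the
  next index.\<close>

lemma hyp_coeff_Suc:
  "hyp_coeff (Suc n) (Suc k) = hyp_coeff n (Suc k) + of_nat (n + k) * hyp_coeff n k"
proof -
  define P Q Q' N K :: complex where
    "P = pochhammer (1 - of_nat n) k" and "Q = pochhammer (of_nat n) k"
    and "Q' = pochhammer (of_nat n + 1) k" and "N = of_nat n" and "K = of_nat k"
  define F :: complex where "F = fact k * 2 ^ k"
  have F: "F \<noteq> 0" and K: "K + 1 \<noteq> 0"
    by (simp add: F_def) (metis K_def of_nat_Suc of_nat_eq_0_iff add.commute nat.distinct(1))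
  have QQ: "N * Q' = Q * (N + K)"
    unfolding N_def Q_def Q'_def K_def
    using pochhammer_rec[of "of_nat n :: complex" k] pochhammer_Suc[of "of_nat n :: complex" k] by simp
  have F': "fact (Suc k) * 2 ^ Suc k = F * (2 * (K + 1))"
    by (simp add: F_def K_def algebra_simps)
  have "hyp_coeff (Suc n) (Suc k) =
      (- 1) ^ Suc k * ((- N) * P) * (Q' * (N + 1 + K)) / (F * (2 * (K + 1)))"
    unfolding hyp_coeff_def F'
    using pochhammer_rec[of "- N" k] pochhammer_Suc[of "N + 1" k]
    by (simp add: P_def Q'_def N_def K_def add_ac)
  also have "\<dots> = (- 1) ^ k * P * (N * Q') * (N + K + 1) / (F * (2 * (K + 1)))"
    by (simp add: algebra_simps)
  \<comment> \<open>Up to common factors this is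
    \<open>N + K + 1 = (N - 1 - K) + 2 * (K + 1)\<close>.\<close>
  also have "\<dots> = (- 1) ^ k * P * Q * (N + K) * (N - 1 - K) / (F * (2 * (K + 1)))
       + (N + K) * ((- 1) ^ k * P * Q / F)"
    unfolding QQ using F K by (simp add: divide_simps) algebra
  also have "(- 1) ^ k * P * Q * (N + K) * (N - 1 - K) / (F * (2 * (K + 1))) = hyp_coeff n (Suc k)"
    unfolding hyp_coeff_def F'
    by (simp add: pochhammer_Suc P_def Q_def N_def K_def algebra_simps)
  finally show ?thesis
    by (simp add: hyp_coeff_def P_def Q_def N_def K_def F_def)
qed

section \<open>Complex arguments and the raising relation\<close>

definition A_cx :: "nat \<Rightarrow> complex \<Rightarrow> complex \<Rightarrow> complex" where
  "A_cx n l w = (\<Sum>k\<le>n. hyp_coeff n k * euler_g l (n - k) w)"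

text \<open>The factor \<open>(1 + x) ^ k\<close> in the \<open>k\<close>-th term of
  \<open>frak_P\<close> reduces the exponent \<open>l + n\<close> of the denominator to
  \<open>l + (n - k)\<close>.\<close>

lemma frak_A_eq_A_cx:
  assumes x: "x > - 1"
  shows "frak_A n l x = A_cx n l (of_real x)"
proof -
  have nz: "1 + of_real x \<noteq> (0 :: complex)"
    using slit_nonzero[OF of_real_in_slit[OF x]] .
  have "frak_A n l x = (\<Sum>k\<le>n. (- 1) ^ k * pochhammer (1 - of_nat n) k * pochhammer (of_nat n) k / fact k *
       pochhammer l (n - k) * of_real x ^ (n - k) * of_real ((1 + x) / 2) ^ k /
       of_real (x + 1) powr (l + of_nat n))"
    by (simp only: frak_A_def frak_P_polynomial sum_divide_distrib)
  also have "\<dots> = A_cx n l (of_real x)"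
    unfolding A_cx_def
  proof (rule sum.cong[OF refl])
    fix k assume "k \<in> {..n}"
    then have k: "k \<le> n" by simp
    have "(1 + of_real x :: complex) powr (l + of_nat n) =
        (1 + of_real x) powr (l + of_nat (n - k) + of_nat k)"
      using k by (simp add: of_nat_diff)
    also have "\<dots> = (1 + of_real x) powr (l + of_nat (n - k)) * (1 + of_real x) ^ k"
      unfolding powr_add[of _ "l + of_nat (n - k)"] using nz by (simp add: powr_nat')
    finally have "(1 + of_real x :: complex) powr (l + of_nat n) =
        (1 + of_real x) powr (l + of_nat (n - k)) * (1 + of_real x) ^ k" .
    then have p: "of_real ((1 + x) / 2) ^ k / of_real (x + 1) powr (l + of_nat n) =
        (1 + of_real x :: complex) powr (- (l + of_nat (n - k))) / 2 ^ k"
      using nz by (simp add: powr_minus[of _ "l + of_nat (n - k)"] power_divide divide_simps add.commute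
          del: minus_add_distrib)
    have "(- 1) ^ k * pochhammer (1 - of_nat n) k * pochhammer (of_nat n) k / fact k *
       pochhammer l (n - k) * of_real x ^ (n - k) * of_real ((1 + x) / 2) ^ k /
       of_real (x + 1) powr (l + of_nat n) =
      (- 1) ^ k * pochhammer (1 - of_nat n) k * pochhammer (of_nat n) k / fact k *
       pochhammer l (n - k) * of_real x ^ (n - k) *
      (of_real ((1 + x) / 2) ^ k / of_real (x + 1) powr (l + of_nat n))"
      by (simp only: times_divide_eq_right)
    also have "\<dots> = hyp_coeff n k * euler_g l (n - k) (of_real x)"
      unfolding p by (simp add: hyp_coeff_def euler_g_def)
    finally show "(- 1) ^ k * pochhammer (1 - of_nat n) k * pochhammer (of_nat n) k / fact k *
       pochhammer l (n - k) * of_real x ^ (n - k) * of_real ((1 + x) / 2) ^ k /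
       of_real (x + 1) powr (l + of_nat n) = hyp_coeff n k * euler_g l (n - k) (of_real x)" .
  qed
  finally show ?thesis .
qed

lemma A_cx_raising:
  assumes w: "w \<in> slit"
  shows "(A_cx n l has_field_derivative deriv (A_cx n l) w) (at w)"
    and "w * deriv (A_cx n l) w = 2 * of_nat n * A_cx n l w - A_cx (Suc n) l w"
proof -
  have "\<forall>m. \<exists>d. (euler_g l m has_field_derivative d) (at w) \<and>
      w * d = of_nat m * euler_g l m w - euler_g l (Suc m) w"
    using euler_g_deriv[OF w] by metis
  then obtain d where d: "\<And>m. (euler_g l m has_field_derivative d m) (at w)"
    and wd: "\<And>m. w * d m = of_nat m * euler_g l m w - euler_g l (Suc m) w"
    by metis
  let ?D = "\<Sum>k\<le>n. hyp_coeff n k * d (n - k)"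
  let ?g = "\<lambda>m. euler_g l m w"
  have D: "(A_cx n l has_field_derivative ?D) (at w)"
    unfolding A_cx_def by (intro DERIV_sum DERIV_cmult d)
  then have dD: "deriv (A_cx n l) w = ?D" by (rule DERIV_imp_deriv)
  show "(A_cx n l has_field_derivative deriv (A_cx n l) w) (at w)"
    using D dD by simp
  have shift: "(\<Sum>k\<le>n. hyp_coeff n k * ?g (Suc (n - k))) =
      ?g (Suc n) + (\<Sum>k\<le>n. hyp_coeff n (Suc k) * ?g (n - k))"
  proof -
    \<comment> \<open>The new term \<open>k = Suc n\<close> is zero; afterwards \<open>k = 0\<close>
      splits off as the leading term.\<close>
    have "(\<Sum>k\<le>n. hyp_coeff n k * ?g (Suc (n - k))) = (\<Sum>k\<le>Suc n. hyp_coeff n k * ?g (Suc n - k))"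
      by (simp add: hyp_coeff_eq_0 Suc_diff_le)
    then show ?thesis by (simp only: sum.atMost_Suc_shift hyp_coeff_0) simp
  qed
  have "2 * of_nat n * A_cx n l w - w * ?D =
      (\<Sum>k\<le>n. hyp_coeff n k * (2 * of_nat n * ?g (n - k)
        - (of_nat (n - k) * ?g (n - k) - ?g (Suc (n - k)))))"
    unfolding A_cx_def sum_distrib_left sum_subtractf[symmetric] wd[symmetric]
    by (simp add: algebra_simps)
  also have "\<dots> = (\<Sum>k\<le>n. of_nat (n + k) * hyp_coeff n k * ?g (n - k) + hyp_coeff n k * ?g (Suc (n - k)))"
    by (rule sum.cong[OF refl]) (simp add: of_nat_diff algebra_simps)
  also have "\<dots> = ?g (Suc n) + (\<Sum>k\<le>n. hyp_coeff (Suc n) (Suc k) * ?g (n - k))"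
    unfolding sum.distrib shift hyp_coeff_Suc by (simp add: sum.distrib[symmetric] algebra_simps)
  also have "\<dots> = A_cx (Suc n) l w"
    unfolding A_cx_def by (simp only: sum.atMost_Suc_shift hyp_coeff_0) simp
  finally show "w * deriv (A_cx n l) w = 2 * of_nat n * A_cx n l w - A_cx (Suc n) l w"
    unfolding dD by (simp add: algebra_simps)
qed

section \<open>Initial cases and the three-term recurrence\<close>

lemma A_cx_0: "A_cx 0 l w = (1 + w) powr (- l)"
  by (simp add: A_cx_def hyp_coeff_def euler_g_def)

lemma A_cx_1: "A_cx (Suc 0) l w = l * w * (1 + w) powr (- (l + 1))"
  by (simp add: A_cx_def hyp_coeff_def euler_g_def del: minus_add_distrib minus_add)

lemma A_cx_2:
  "A_cx (Suc (Suc 0)) l w =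
     l * (l + 1) * w ^ 2 * (1 + w) powr (- (l + 2)) + l * w * (1 + w) powr (- (l + 1))"
  by (simp add: A_cx_def hyp_coeff_def euler_g_def pochhammer_Suc power2_eq_square
      del: minus_add_distrib minus_add)

text \<open>The induction closes because
  \<open>rec_beta l (Suc n) = rec_beta l n + 2 * (4 * n + 2 * l + 3)\<close>; the increment arises
  from differentiating \<open>w ^ 2\<close> in the middle coefficient.\<close>

lemma A_cx_three_term:
  assumes w: "w \<in> slit"
  shows "(w ^ 2 - 1) * A_cx (Suc (Suc n)) l w
      + (2 * of_nat n + 1 - (4 * of_nat n + 2 * l + 3) * w ^ 2) * A_cx (Suc n) l w
      + rec_beta l n * w ^ 2 * A_cx n l w = 0"
  using w
proof (induction n arbitrary: w)
  case 0
  \<comment> \<open>The lowest exponent among the three functions; factoring it out leaves a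
    polynomial identity.\<close>
  define q where "q = (1 + w) powr (- (l + 2))"
  have e1: "- (l + 1) = - (l + 2) + 1" and e0: "- l = - (l + 2) + 2"
    by simp_all
  have q1: "(1 + w) powr (- (l + 1)) = q * (1 + w)"
    unfolding e1 powr_add q_def using slit_nonzero[OF 0] by simp
  have q0: "(1 + w) powr (- l) = q * (1 + w) ^ 2"
    unfolding q_def by (subst e0, subst powr_add) (use slit_nonzero[OF 0] in simp)
  show ?case
    unfolding A_cx_0 A_cx_1 A_cx_2 q1 q0 rec_beta_def q_def[symmetric]
    by (simp add: algebra_simps power2_eq_square)
next
  case (Suc n)
  let ?R = "\<lambda>w. (w ^ 2 - 1) * A_cx (Suc (Suc n)) l w
      + (2 * of_nat n + 1 - (4 * of_nat n + 2 * l + 3) * w ^ 2) * A_cx (Suc n) l w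
      + rec_beta l n * w ^ 2 * A_cx n l w"
  let ?A = "\<lambda>m. A_cx m l w" and ?A' = "\<lambda>m. deriv (A_cx m l) w"
  let ?D = "2 * w * ?A (Suc (Suc n)) + (w ^ 2 - 1) * ?A' (Suc (Suc n))
      - (4 * of_nat n + 2 * l + 3) * (2 * w) * ?A (Suc n)
      + (2 * of_nat n + 1 - (4 * of_nat n + 2 * l + 3) * w ^ 2) * ?A' (Suc n)
      + rec_beta l n * (2 * w) * ?A n + rec_beta l n * w ^ 2 * ?A' n"
  have "(?R has_field_derivative ?D) (at w)"
    by (rule derivative_eq_intros A_cx_raising(1)[OF Suc.prems] refl)+ (simp add: algebra_simps)
  \<comment> \<open>By the induction hypothesis \<open>?R\<close> vanishes on all of the open set
    \<open>slit\<close>.\<close>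
  moreover have "(?R has_field_derivative 0) (at w)"
    by (rule has_field_derivative_transform_within_open[OF DERIV_const open_slit Suc.prems])
      (use Suc.IH in simp)
  ultimately have "?D = 0" by (rule DERIV_unique)
  \<comment> \<open>Every derivative now occurs as \<open>w * deriv\<close>, which the raising
    relation eliminates.\<close>
  then have "w * ?D = 0" by simp
  then have "2 * w ^ 2 * ?A (Suc (Suc n)) + (w ^ 2 - 1) * (w * ?A' (Suc (Suc n)))
      - (4 * of_nat n + 2 * l + 3) * (2 * w ^ 2) * ?A (Suc n)
      + (2 * of_nat n + 1 - (4 * of_nat n + 2 * l + 3) * w ^ 2) * (w * ?A' (Suc n))
      + rec_beta l n * (2 * w ^ 2) * ?A n + rec_beta l n * w ^ 2 * (w * ?A' n) = 0"
    by (simp add: algebra_simps power2_eq_square)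
  note e = this[unfolded A_cx_raising(2)[OF Suc.prems]]
  \<comment> \<open>\<open>2 n + 2\<close> times this equation, minus \<open>e\<close>, is the
    claim.\<close>
  have "?R w = 0" using Suc by blast
  then show ?case
    using e unfolding rec_beta_def of_nat_Suc by algebra
qed

section \<open>Power series in \<open>z\<close>\<close>

text \<open>The functional equation \<open>y * rGamma (y + 1) = rGamma y\<close> at
  \<open>y = x - n\<close>. It also holds at the poles of \<open>Gamma\<close>, which
  \<open>j / 2 - n + 1\<close> meets for even \<open>j < 2 n\<close>.\<close>

lemma Gamma_rGamma_Suc:
  fixes x :: complex
  shows "Gamma (x + 1) * rGamma (x - of_nat (Suc n) + 1) =
    (x - of_nat n) * (Gamma (x + 1) * rGamma (x - of_nat n + 1))"
  using rGamma_plus1[of "x - of_nat n"] by (simp add: algebra_simps)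

text \<open>The Gamma quotient is a falling factorial of \<open>j / 2\<close>, so this is
  \<open>(- l) gchoose j\<close> times the product of \<open>2 i - j\<close> over
  \<open>i < n\<close>.\<close>

definition z_coeff :: "nat \<Rightarrow> complex \<Rightarrow> nat \<Rightarrow> complex" where
  "z_coeff n l j = 2 ^ n * ((- 1) ^ (j + n) * pochhammer l j *
     (Gamma (of_nat j / 2 + 1) * rGamma (of_nat j / 2 - of_nat n + 1)) / fact j)"

lemma z_coeff_0: "z_coeff 0 l j = (- l) gchoose j"
proof -
  have "of_nat j / 2 + 1 \<notin> (\<int>\<^sub>\<le>\<^sub>0 :: complex set)"
  proof
    assume "of_nat j / 2 + 1 \<in> (\<int>\<^sub>\<le>\<^sub>0 :: complex set)"
    then obtain i where i: "of_nat j / 2 + 1 = (of_int i :: complex)" "i \<le> 0"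
      by (auto elim!: nonpos_Ints_cases)
    have "real j / 2 + 1 = of_int i"
      using arg_cong[OF i(1), of Re] by simp
    then show False using i(2) by (smt (verit) of_nat_0_le_iff of_int_le_0_iff divide_nonneg_nonneg)
  qed
  then have "Gamma (of_nat j / 2 + 1) * rGamma (of_nat j / 2 + 1 :: complex) = 1"
    by (simp add: rGamma_inverse_Gamma Gamma_eq_zero_iff)
  then show ?thesis
    by (simp add: z_coeff_def gbinomial_pochhammer)
qed

text \<open>Since \<open>\<theta>\<close> multiplies \<open>w ^ j\<close> by \<open>j\<close>, this
  is the raising relation on coefficients.\<close>

lemma z_coeff_Suc: "z_coeff (Suc n) l j = 2 * of_nat n * z_coeff n l j - of_nat j * z_coeff n l j"
  unfolding z_coeff_def Gamma_rGamma_Suc by (simp add: field_simps)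

text \<open>The expansion is known only on \<open>U\<close>, which need not contain a full disc. But
  \<open>U\<close> contains a real \<open>K\<close> between \<open>norm w\<close> and
  \<open>r\<close>, and convergence at \<open>K\<close> permits termwise differentiation at
  \<open>w\<close>.\<close>

lemma sums_euler_operator:
  fixes c :: "nat \<Rightarrow> complex"
  assumes F: "\<And>u. u \<in> U \<Longrightarrow> norm u < r \<Longrightarrow> (\<lambda>j. c j * u ^ j) sums F u"
    and U: "open U" "\<And>x. x > 0 \<Longrightarrow> of_real x \<in> U"
    and w: "w \<in> U" "norm w < r"
  shows "(\<lambda>j. of_nat j * c j * w ^ j) sums (w * deriv F w)"
proof -
  obtain K where K: "norm w < K" "K < r" using dense[OF w(2)] by blast
  then have K0: "K > 0" using norm_ge_zero[of w] by linarith
  then have sK: "summable (\<lambda>j. c j * of_real K ^ j)"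
    using F[OF U(2)[OF K0]] K(2) by (simp add: sums_iff)
  have D: "((\<lambda>x. \<Sum>j. c j * x ^ j) has_field_derivative (\<Sum>j. diffs c j * w ^ j)) (at w)"
    by (rule termdiffs_strong[OF sK]) (use K K0 in simp)
  have "(F has_field_derivative (\<Sum>j. diffs c j * w ^ j)) (at w)"
    by (rule has_field_derivative_transform_within_open[OF D, of "U \<inter> ball 0 r"])
      (use U(1) w F in \<open>auto simp: sums_iff\<close>)
  then have dF: "deriv F w = (\<Sum>j. diffs c j * w ^ j)" by (rule DERIV_imp_deriv)
  have "summable (\<lambda>j. diffs c j * w ^ j)"
    by (rule termdiff_converges[OF K(1)]) (rule powser_inside[OF sK], use K0 in simp)
  then have "(\<lambda>j. w * (of_nat j * c j * w ^ (j - Suc 0))) sums (w * deriv F w)"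
    unfolding dF by (intro sums_mult diffs_equiv)
  moreover have "w * (of_nat j * c j * w ^ (j - Suc 0)) = of_nat j * c j * w ^ j" for j
    by (cases j) auto
  ultimately show ?thesis by simp
qed

lemma binomial_sums:
  fixes l :: complex
  assumes w: "w \<in> slit" and l: "- l \<in> \<nat> \<or> norm w < 1"
  shows "(\<lambda>j. ((- l) gchoose j) * w ^ j) sums (1 + w) powr (- l)"
proof (cases "- l \<in> \<nat>")
  case True
  then obtain N where N: "- l = of_nat N" by (auto elim: Nats_cases)
  have "(\<lambda>j. (of_nat N gchoose j) * w ^ j) sums (\<Sum>j\<le>N. (of_nat N gchoose j) * w ^ j)"
    by (rule sums_finite) (auto simp: binomial_gbinomial[symmetric])
  also have "(\<Sum>j\<le>N. (of_nat N gchoose j) * w ^ j) = (w + 1) ^ N"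
    by (simp add: binomial_ring binomial_gbinomial)
  finally show ?thesis
    unfolding N using slit_nonzero[OF w] by (simp add: powr_nat add.commute)
next
  case False
  then show ?thesis using l by (auto intro!: gen_binomial_complex)
qed

text \<open>For \<open>- l \<in> \<nat>\<close> the series is a finite sum and \<open>r\<close> is
  arbitrary; otherwise the binomial series confines it to \<open>r \<le> 1\<close>.\<close>

lemma A_cx_sums:
  assumes "w \<in> slit" "norm w < r" and l: "- l \<in> \<nat> \<or> r \<le> 1"
  shows "(\<lambda>j. z_coeff n l j * w ^ j) sums A_cx n l w"
  using assms(1,2)
proof (induction n arbitrary: w)
  case 0
  then show ?case
    unfolding z_coeff_0 A_cx_0 using l by (intro binomial_sums) auto
next
  case (Suc n)
  have "(\<lambda>j. of_nat j * z_coeff n l j * w ^ j) sums (w * deriv (A_cx n l) w)"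
    by (rule sums_euler_operator[of slit r, OF Suc.IH open_slit])
      (use Suc.prems in \<open>auto intro: of_real_in_slit\<close>)
  from sums_diff[OF sums_mult[OF Suc.IH[OF Suc.prems], of "2 * of_nat n"] this]
  show ?case
    unfolding A_cx_raising(2)[OF Suc.prems(1)] z_coeff_Suc by (simp add: algebra_simps)
qed

section \<open>Taylor expansion in \<open>t\<close>\<close>

text \<open>The formula is proved on the open set \<open>S\<close> so that it can be differentiated
  again. The denominator contributes the \<open>2 n\<close>, the inner argument the
  \<open>- \<theta>\<close>, of the raising relation.\<close>

lemma gen_f_higher_deriv:
  assumes S: "S = {t \<in> ball 0 1. of_real z * csqrt (1 - t) \<in> slit}" and t: "t \<in> S"
  shows "(deriv ^^ n) (\<lambda>t. gen_f l t z) t =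
    A_cx n l (of_real z * csqrt (1 - t)) / (2 * (1 - t)) ^ n"
  using t
proof (induction n arbitrary: t)
  case 0
  then show ?case by (simp add: A_cx_0 gen_f_def)
next
  case (Suc n)
  have pos: "1 - t \<notin> \<real>\<^sub>\<le>\<^sub>0" if "t \<in> ball 0 1" for t :: complex
    using that complex_Re_le_cmod[of t] by (auto simp: complex_nonpos_Reals_iff)
  have "continuous_on (ball 0 1) (\<lambda>t. of_real z * csqrt (1 - t))"
    using pos by (intro holomorphic_on_imp_continuous_on holomorphic_intros) auto
  then have "open (ball 0 1 \<inter> (\<lambda>t. of_real z * csqrt (1 - t)) -` slit)"
    by (rule continuous_open_preimage[OF _ open_ball open_slit])
  moreover have "ball 0 1 \<inter> (\<lambda>t. of_real z * csqrt (1 - t)) -` slit = S"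
    unfolding S by auto
  ultimately have oS: "open S" by simp
  define s where "s = csqrt (1 - t)"
  have t1: "1 - t \<notin> \<real>\<^sub>\<le>\<^sub>0" using Suc.prems pos by (auto simp: S)
  have nz: "1 - t \<noteq> 0" "s \<noteq> 0" using t1 by (auto simp: s_def)
  have s2: "s ^ 2 = 1 - t" by (simp add: s_def)
  have w: "of_real z * s \<in> slit" using Suc.prems by (simp add: S s_def)
  let ?A' = "deriv (A_cx n l) (of_real z * s)" and ?A = "A_cx n l (of_real z * s)"
  have dw: "((\<lambda>t. of_real z * csqrt (1 - t)) has_field_derivative (- of_real z / (2 * s))) (at t)"
    using t1 by (auto intro!: derivative_eq_intros simp: s_def)
  have dA: "((\<lambda>t. A_cx n l (of_real z * csqrt (1 - t))) has_field_derivative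
      ?A' * (- of_real z / (2 * s))) (at t)"
    by (rule DERIV_chain2[OF _ dw]) (use A_cx_raising(1)[OF w] in \<open>simp add: s_def\<close>)
  have dq: "((\<lambda>t. (2 * (1 - t)) ^ n) has_field_derivative
      of_nat n * (2 * (1 - t)) ^ (n - 1) * (- 2)) (at t)"
    by (auto intro!: derivative_eq_intros)
  have "((\<lambda>t. A_cx n l (of_real z * csqrt (1 - t)) / (2 * (1 - t)) ^ n) has_field_derivative
      (?A' * (- of_real z / (2 * s)) * (2 * (1 - t)) ^ n
        - ?A * (of_nat n * (2 * (1 - t)) ^ (n - 1) * (- 2))) /
      ((2 * (1 - t)) ^ n * (2 * (1 - t)) ^ n)) (at t)"
    using DERIV_divide[OF dA dq] nz by (simp add: s_def)
  moreover have "(?A' * (- of_real z / (2 * s)) * (2 * (1 - t)) ^ n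
        - ?A * (of_nat n * (2 * (1 - t)) ^ (n - 1) * (- 2))) /
      ((2 * (1 - t)) ^ n * (2 * (1 - t)) ^ n) =
      A_cx (Suc n) l (of_real z * s) / (2 * (1 - t)) ^ Suc n"
  proof -
    define q where "q = 2 * (1 - t)"
    have q: "q \<noteq> 0" using nz by (simp add: q_def)
    \<comment> \<open>As \<open>s ^ 2 = 1 - t\<close>, the inner derivative is
      \<open>- w / q\<close> with \<open>w = z * s\<close>.\<close>
    have e1: "- of_real z / (2 * s) = - (of_real z * s) / q"
      using nz by (simp add: q_def s2[symmetric] power2_eq_square)
    have e2: "of_nat n * q ^ (n - 1) = of_nat n * q ^ n / q"
      using q by (cases n) auto
    have "(?A' * (- of_real z / (2 * s)) * q ^ n - ?A * (of_nat n * q ^ (n - 1) * (- 2))) / (q ^ n * q ^ n)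
       = (2 * of_nat n * ?A - of_real z * s * ?A') / q ^ Suc n"
      unfolding e1 e2 using q by (simp add: field_simps)
    also have "\<dots> = A_cx (Suc n) l (of_real z * s) / q ^ Suc n"
      unfolding A_cx_raising(2)[OF w] by simp
    finally show ?thesis by (simp only: q_def)
  qed
  ultimately have "((\<lambda>t. A_cx n l (of_real z * csqrt (1 - t)) / (2 * (1 - t)) ^ n) has_field_derivative
      A_cx (Suc n) l (of_real z * s) / (2 * (1 - t)) ^ Suc n) (at t)"
    by (simp only:)
  then have "((deriv ^^ n) (\<lambda>t. gen_f l t z) has_field_derivative
      A_cx (Suc n) l (of_real z * s) / (2 * (1 - t)) ^ Suc n) (at t)"
    by (rule has_field_derivative_transform_within_open[OF _ oS Suc.prems]) (simp add: Suc.IH)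
  then show ?case by (simp add: DERIV_imp_deriv s_def)
qed

text \<open>Holomorphy on the ball gives convergence of the Taylor series to \<open>gen_f\<close>;
  its coefficients are read off at \<open>t = 0\<close>, where \<open>z * csqrt (1 - t)\<close> is
  \<open>z\<close>.\<close>

lemma gen_f_sums:
  assumes z: "z > - 1"
    and R: "R = (if z < - (2 powr (- 1 / 2)) \<and> - l \<notin> \<nat> - {0} then 1 / z ^ 2 - 1 else 1)"
    and t: "norm t < R"
  shows "(\<lambda>n. frak_A n l z / (2 ^ n * fact n) * t ^ n) sums gen_f l t z"
proof -
  have "(\<lambda>n. (deriv ^^ n) (\<lambda>t. gen_f l t z) 0 / fact n * (t - 0) ^ n) sums gen_f l t z"
    by (rule holomorphic_power_series[OF gen_f_holomorphic(1)[OF z R]]) (use t in simp)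
  moreover have "(deriv ^^ n) (\<lambda>t. gen_f l t z) 0 = frak_A n l z / 2 ^ n" for n
    using gen_f_higher_deriv[OF refl, of 0 z n l] of_real_in_slit[OF z] frak_A_eq_A_cx[OF z] by simp
  ultimately show ?thesis by simp
qed

section \<open>Regularity in \<open>z\<close> and \<open>l\<close>, and assembly of the
  claims\<close>

lemma frak_A_has_vector_derivative:
  assumes z: "z > - 1"
  shows "((\<lambda>x. frak_A n l x) has_vector_derivative deriv (A_cx n l) (of_real z)) (at z)"
proof -
  have "((\<lambda>x. A_cx n l (of_real x)) has_vector_derivative deriv (A_cx n l) (of_real z)) (at z)"
    by (rule has_vector_derivative_real_field[OF A_cx_raising(1)[OF of_real_in_slit[OF z]]])
  then show ?thesis
    by (rule has_vector_derivative_transform_within_open[of _ _ _ "{- 1<..}"])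
      (use z in \<open>auto simp: frak_A_eq_A_cx\<close>)
qed

text \<open>The numerator is a polynomial in \<open>m\<close>, and a power of the nonzero base
  \<open>z + 1\<close> is entire and zero-free in the exponent.\<close>

lemma frak_A_analytic:
  assumes z: "z > - 1"
  shows "(\<lambda>m. frak_A n m z) analytic_on UNIV"
proof -
  have "of_real (z + 1) \<noteq> (0 :: complex)" using z by (simp only: of_real_eq_0_iff)
  then have "(\<lambda>m. frak_A n m z) holomorphic_on UNIV"
    unfolding frak_A_def frak_P_polynomial pochhammer_prod
    by (intro holomorphic_intros) auto
  then show ?thesis by (simp add: analytic_on_open)
qed

theorem theorem26:
  fixes z :: real and l :: complex
  assumes z: "z > - 1"
  shows
    "(\<forall>t :: complex.
        (z < - (2 powr (- 1 / 2)) \<and> - l \<notin> \<nat> - {0} \<longrightarrow> norm t < 1 / z ^ 2 - 1) \<longrightarrow>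
        (z \<ge> - (2 powr (- 1 / 2)) \<or> - l \<in> \<nat> - {0} \<longrightarrow> norm t < 1) \<longrightarrow>
        (\<lambda>n. frak_A n l z / (2 ^ n * fact n) * t ^ n) sums gen_f l t z)
     \<and> (- l \<in> \<nat> \<or> \<bar>z\<bar> < 1 \<longrightarrow>
         (\<forall>n. summable (\<lambda>j. (- 1) ^ (j + n) * pochhammer l j *
                 (Gamma (of_nat j / 2 + 1) * rGamma (of_nat j / 2 - of_nat n + 1)) *
                 (of_real z ^ j / fact j))
            \<and> frak_A n l z = 2 ^ n *
                (\<Sum>j. (- 1) ^ (j + n) * pochhammer l j *
                 (Gamma (of_nat j / 2 + 1) * rGamma (of_nat j / 2 - of_nat n + 1)) *
                 (of_real z ^ j / fact j))))
     \<and> (\<forall>n. (\<lambda>m. frak_A n m z) analytic_on UNIV)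
     \<and> (\<forall>n. (\<lambda>x. frak_A n l x) differentiable (at z)
            \<and> frak_A (n + 1) l z =
                2 * of_nat n * frak_A n l z
                - of_real z * vector_derivative (\<lambda>x. frak_A n l x) (at z))
     \<and> frak_A 0 l z = 1 / of_real (1 + z) powr l
     \<and> frak_A 1 l z = l * of_real z / of_real (1 + z) powr (l + 1)
     \<and> (\<forall>n. (of_real z ^ 2 - 1) * frak_A (n + 2) l z
             + rec_alpha z l n * frak_A (n + 1) l z
             + rec_beta l n * of_real z ^ 2 * frak_A n l z = 0)"
proof (intro conjI)
  note A = frak_A_eq_A_cx[OF z] and slit = of_real_in_slit[OF z]
  show "\<forall>t :: complex.
        (z < - (2 powr (- 1 / 2)) \<and> - l \<notin> \<nat> - {0} \<longrightarrow> norm t < 1 / z ^ 2 - 1) \<longrightarrow>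
        (z \<ge> - (2 powr (- 1 / 2)) \<or> - l \<in> \<nat> - {0} \<longrightarrow> norm t < 1) \<longrightarrow>
        (\<lambda>n. frak_A n l z / (2 ^ n * fact n) * t ^ n) sums gen_f l t z"
    by (intro allI impI gen_f_sums[OF z refl]) (auto simp: not_less)
  show "- l \<in> \<nat> \<or> \<bar>z\<bar> < 1 \<longrightarrow>
         (\<forall>n. summable (\<lambda>j. (- 1) ^ (j + n) * pochhammer l j *
                 (Gamma (of_nat j / 2 + 1) * rGamma (of_nat j / 2 - of_nat n + 1)) *
                 (of_real z ^ j / fact j))
            \<and> frak_A n l z = 2 ^ n *
                (\<Sum>j. (- 1) ^ (j + n) * pochhammer l j *
                 (Gamma (of_nat j / 2 + 1) * rGamma (of_nat j / 2 - of_nat n + 1)) *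
                 (of_real z ^ j / fact j)))"
    (is "_ \<longrightarrow> (\<forall>n. summable (?a n) \<and> _ = _ * suminf (?a n))")
  proof (intro impI allI)
    fix n assume l: "- l \<in> \<nat> \<or> \<bar>z\<bar> < 1"
    \<comment> \<open>In the polynomial case any radius above \<open>|z|\<close> serves, such as
      \<open>|z| + 1\<close>.\<close>
    have "(\<lambda>j. z_coeff n l j * of_real z ^ j) sums frak_A n l z"
      unfolding A by (rule A_cx_sums[OF slit, of "if - l \<in> \<nat> then \<bar>z\<bar> + 1 else 1"]) (use l in auto)
    moreover have "z_coeff n l j * of_real z ^ j = 2 ^ n * ?a n j" for j
      by (simp add: z_coeff_def)
    ultimately have "(\<lambda>j. 2 ^ n * ?a n j) sums frak_A n l z" by (simp only:)
    from sums_mult[OF this, of "1 / 2 ^ n"]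
    have "?a n sums (frak_A n l z / 2 ^ n)" by simp
    then show "summable (?a n) \<and> frak_A n l z = 2 ^ n * suminf (?a n)"
      by (simp add: sums_iff)
  qed
  show "\<forall>n. (\<lambda>m. frak_A n m z) analytic_on UNIV"
    using frak_A_analytic[OF z] by blast
  show "\<forall>n. (\<lambda>x. frak_A n l x) differentiable (at z)
            \<and> frak_A (n + 1) l z =
                2 * of_nat n * frak_A n l z
                - of_real z * vector_derivative (\<lambda>x. frak_A n l x) (at z)"
  proof (intro allI conjI)
    fix n
    note D = frak_A_has_vector_derivative[OF z, of n l]
    show "(\<lambda>x. frak_A n l x) differentiable (at z)"
      using D by (rule differentiableI_vector)
    show "frak_A (n + 1) l z = 2 * of_nat n * frak_A n l z
        - of_real z * vector_derivative (\<lambda>x. frak_A n l x) (at z)"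
      unfolding vector_derivative_at[OF D] A_cx_raising(2)[OF slit] by (simp add: A)
  qed
  show "frak_A 0 l z = 1 / of_real (1 + z) powr l"
    by (simp add: A A_cx_0 powr_minus_divide)
  show "frak_A 1 l z = l * of_real z / of_real (1 + z) powr (l + 1)"
    by (simp add: A A_cx_1 powr_minus_divide[of _ "l + 1"] del: minus_add_distrib)
  show "\<forall>n. (of_real z ^ 2 - 1) * frak_A (n + 2) l z
             + rec_alpha z l n * frak_A (n + 1) l z
             + rec_beta l n * of_real z ^ 2 * frak_A n l z = 0"
    using A_cx_three_term[OF slit, of _ l] by (simp add: A rec_alpha_def)
qed

end
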